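(* The set of all metrics $d\in\mathrm{Met}(\mathbb{Q})$ such that $(\mathbb{Q},d)$ is the rational Urysohn universal metric space (that is, isometric to it) is meager in $\mathrm{Met}(\mathbb{Q})$.
   Context: $\mathbb{Q}$ carries its usual topology. $\mathrm{Met}(\mathbb{Q})$ denotes the set of all metrics on $\mathbb{Q}$ that generate this topology, with the topology generated by the open balls of the $[0,\infty]$-valued metric $\mathcal{D}_{\mathbb{Q}}(d,e)=\sup_{x,y\in\mathbb{Q}}|d(x,y)-e(x,y)|$. Let $\mathscr{Q}$ be the class of all finite metric spaces whose metrics take values in $\mathbb{Q}$. A metric space $(X,d)$ is $\mathscr{Q}$-injective if for every $(A,m)\in\mathscr{Q}$ and every subset $B\subset A$ (possibly empty), every isometric embedding $\phi\colon(B,m|_{B^{2}})\to(X,d)$ can be extended to an isometric embedding $\Phi\colon(A,m)\to(X,d)$. The rational Urysohn universal metric space is the countable $\mathscr{Q}$-injective metric space whose metric takes values in $\mathbb{Q}$; it exists and is unique up to isometry. A subset of a topological space is meager if it is a countable union of nowhere dense subsets. *)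

theory Defs
  imports "HOL-Analysis.Analysis"
begin

definition nowhere_dense_in :: "'a topology \<Rightarrow> 'a set \<Rightarrow> bool" where
  "nowhere_dense_in X S \<longleftrightarrow> S \<subseteq> topspace X \<and> X interior_of (X closure_of S) = {}"

definition meager_in :: "'a topology \<Rightarrow> 'a set \<Rightarrow> bool" where
  "meager_in X S \<longleftrightarrow> (\<exists>N :: nat \<Rightarrow> 'a set. (\<forall>n. nowhere_dense_in X (N n)) \<and> S = (\<Union>n. N n))"

text \<open>The type \<^typ>\<open>rat\<close> is not an instance of the topological type classes, so the usual topology
  is written as the one induced by the inclusion into the real line.\<close>

definition rat_topology :: "rat topology" where
  "rat_topology = pullback_topology UNIV real_of_rat euclideanreal"

definition Met_rat :: "(rat \<Rightarrow> rat \<Rightarrow> real) set" where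
  "Met_rat = {d. Metric_space UNIV d \<and> Metric_space.mtopology UNIV d = rat_topology}"

definition sup_dist_rat :: "(rat \<Rightarrow> rat \<Rightarrow> real) \<Rightarrow> (rat \<Rightarrow> rat \<Rightarrow> real) \<Rightarrow> ennreal" where
  "sup_dist_rat d e = (SUP (x, y) \<in> UNIV. ennreal \<bar>d x y - e x y\<bar>)"

definition Met_rat_topology :: "(rat \<Rightarrow> rat \<Rightarrow> real) topology" where
  "Met_rat_topology = topology_generated_by
     {{e \<in> Met_rat. sup_dist_rat d e < ennreal r} | d r. d \<in> Met_rat \<and> r > 0}"

definition isometric_embedding ::
    "'a set \<Rightarrow> ('a \<Rightarrow> 'a \<Rightarrow> real) \<Rightarrow> 'b set \<Rightarrow> ('b \<Rightarrow> 'b \<Rightarrow> real) \<Rightarrow> ('a \<Rightarrow> 'b) \<Rightarrow> bool" where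
  "isometric_embedding A m X d f \<longleftrightarrow>
     f \<in> A \<rightarrow> X \<and> (\<forall>x\<in>A. \<forall>y\<in>A. d (f x) (f y) = m x y)"

definition isometric_spaces ::
    "'a set \<Rightarrow> ('a \<Rightarrow> 'a \<Rightarrow> real) \<Rightarrow> 'b set \<Rightarrow> ('b \<Rightarrow> 'b \<Rightarrow> real) \<Rightarrow> bool" where
  "isometric_spaces X d Y e \<longleftrightarrow> (\<exists>f. isometric_embedding X d Y e f \<and> f ` X = Y)"

definition rational_valued :: "'a set \<Rightarrow> ('a \<Rightarrow> 'a \<Rightarrow> real) \<Rightarrow> bool" where
  "rational_valued X d \<longleftrightarrow> (\<forall>x\<in>X. \<forall>y\<in>X. d x y \<in> \<rat>)"

text \<open>A definition cannot quantify over all types, so the finite metric spaces with rational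
  distances are represented by those whose carrier is a finite set of natural numbers; every
  finite metric space is isometric to one of these.\<close>

definition finite_rational_spaces :: "(nat set \<times> (nat \<Rightarrow> nat \<Rightarrow> real)) set" where
  "finite_rational_spaces = {(A, m). finite A \<and> Metric_space A m \<and> rational_valued A m}"

definition Q_injective :: "'a set \<Rightarrow> ('a \<Rightarrow> 'a \<Rightarrow> real) \<Rightarrow> bool" where
  "Q_injective X d \<longleftrightarrow>
     (\<forall>(A, m) \<in> finite_rational_spaces. \<forall>B \<subseteq> A. \<forall>\<phi>. isometric_embedding B m X d \<phi> \<longrightarrow>
        (\<exists>\<Phi>. isometric_embedding A m X d \<Phi> \<and> (\<forall>b\<in>B. \<Phi> b = \<phi> b)))"

text \<open>These properties determine the space only up to isometry.\<close>

definition rational_Urysohn :: "'a set \<Rightarrow> ('a \<Rightarrow> 'a \<Rightarrow> real) \<Rightarrow> bool" where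
  "rational_Urysohn X d \<longleftrightarrow>
     Metric_space X d \<and> countable X \<and> rational_valued X d \<and> Q_injective X d"

end

theory Submission
  imports Defs
begin

text \<open>Every metric isometric to the rational Urysohn space takes a rational value at the pair (0, 1).
  For a fixed rational \<open>q\<close>, the metrics \<open>d\<close> with \<open>d 0 1 = q\<close> form a closed set without interior, since
  \<open>d + \<epsilon> min(d, 1)\<close> generates the same topology as \<open>d\<close>, is uniformly \<open>\<epsilon>\<close>-close to it (which
  \<open>(1 + \<epsilon>) d\<close> need not be), and has a different value at (0, 1).\<close>

definition perturb :: "real \<Rightarrow> ('a \<Rightarrow> 'a \<Rightarrow> real) \<Rightarrow> 'a \<Rightarrow> 'a \<Rightarrow> real" where
  "perturb \<epsilon> d x y = d x y + \<epsilon> * min (d x y) 1"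

text \<open>The function \<open>t + \<epsilon> * min t 1\<close> is nondecreasing and subadditive on
  the nonnegative reals and vanishes there only at 0, so composing it with a metric gives a
  metric.\<close>

lemma Metric_space_perturb:
  assumes "Metric_space M d" "0 \<le> \<epsilon>"
  shows "Metric_space M (perturb \<epsilon> d)"
proof -
  interpret Metric_space M d by fact
  show ?thesis
  proof
    fix x y show "0 \<le> perturb \<epsilon> d x y"
      using \<open>0 \<le> \<epsilon>\<close> by (simp add: perturb_def)
    show "perturb \<epsilon> d x y = perturb \<epsilon> d y x"
      by (simp add: perturb_def commute)
  next
    fix x y assume "x \<in> M" "y \<in> M"
    have "perturb \<epsilon> d x y = 0 \<longleftrightarrow> d x y = 0"
      using \<open>0 \<le> \<epsilon>\<close> nonneg[of x y] by (auto simp: perturb_def add_nonneg_eq_0_iff)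
    then show "perturb \<epsilon> d x y = 0 \<longleftrightarrow> x = y"
      using \<open>x \<in> M\<close> \<open>y \<in> M\<close> by simp
  next
    fix x y z assume "x \<in> M" "y \<in> M" "z \<in> M"
    then have *: "d x z \<le> d x y + d y z"
      by (rule triangle)
    then have "min (d x z) 1 \<le> min (d x y) 1 + min (d y z) 1"
      using nonneg[of x y] nonneg[of y z] by linarith
    from mult_left_mono[OF this \<open>0 \<le> \<epsilon>\<close>] *
    show "perturb \<epsilon> d x z \<le> perturb \<epsilon> d x y + perturb \<epsilon> d y z"
      by (simp add: perturb_def algebra_simps)
  qed
qed

text \<open>The two metrics are bi-Lipschitz equivalent:
  \<open>d \<le> perturb \<epsilon> d \<le> (1 + \<epsilon>) * d\<close> pointwise. Hence balls nest
  both ways, with radii scaled by at most \<open>1 + \<epsilon>\<close>.\<close>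

lemma mtopology_perturb:
  assumes "Metric_space M d" "0 \<le> \<epsilon>"
  shows "Metric_space.mtopology M (perturb \<epsilon> d) = Metric_space.mtopology M d"
proof -
  interpret d: Metric_space M d by fact
  interpret p: Metric_space M "perturb \<epsilon> d"
    using assms by (rule Metric_space_perturb)
  have p_ball: "p.mball x r \<subseteq> d.mball x r" for x r
  proof
    fix y assume "y \<in> p.mball x r"
    moreover have "d x y \<le> perturb \<epsilon> d x y"
      using \<open>0 \<le> \<epsilon>\<close> by (simp add: perturb_def)
    ultimately show "y \<in> d.mball x r" by auto
  qed
  have d_ball: "d.mball x (r / (1 + \<epsilon>)) \<subseteq> p.mball x r" for x r
  proof
    fix y assume y: "y \<in> d.mball x (r / (1 + \<epsilon>))"
    have "perturb \<epsilon> d x y \<le> (1 + \<epsilon>) * d x y"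
      using mult_left_mono[OF min.cobounded1 \<open>0 \<le> \<epsilon>\<close>, of "d x y" 1]
      by (simp add: perturb_def algebra_simps)
    also have "\<dots> < r"
      using y \<open>0 \<le> \<epsilon>\<close> by (simp add: field_simps)
    finally show "y \<in> p.mball x r" using y by auto
  qed
  have "openin p.mtopology S \<longleftrightarrow> openin d.mtopology S" for S
    unfolding p.openin_mtopology d.openin_mtopology
  proof (intro conj_cong refl all_cong imp_cong iffI)
    fix x assume "\<exists>r>0. p.mball x r \<subseteq> S"
    then obtain r where "r > 0" "p.mball x r \<subseteq> S" by blast
    then show "\<exists>r>0. d.mball x r \<subseteq> S"
      using d_ball[of x r] \<open>0 \<le> \<epsilon>\<close> by (intro exI[of _ "r / (1 + \<epsilon>)"]) auto
  next
    fix x assume "\<exists>r>0. d.mball x r \<subseteq> S"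
    then show "\<exists>r>0. p.mball x r \<subseteq> S"
      using p_ball by blast
  qed
  then show ?thesis by (simp add: topology_eq)
qed

lemma perturb_in_Met_rat:
  assumes "d \<in> Met_rat" "0 \<le> \<epsilon>"
  shows "perturb \<epsilon> d \<in> Met_rat"
  using assms Metric_space_perturb[of UNIV d \<epsilon>] mtopology_perturb[of UNIV d \<epsilon>]
  by (simp add: Met_rat_def)

lemma sup_dist_rat_ge: "ennreal \<bar>d x y - e x y\<bar> \<le> sup_dist_rat d e"
  unfolding sup_dist_rat_def by (rule SUP_upper2[of "(x, y)"]) auto

lemma sup_dist_rat_le:
  assumes "\<And>x y. ennreal \<bar>d x y - e x y\<bar> \<le> r"
  shows "sup_dist_rat d e \<le> r"
  unfolding sup_dist_rat_def using assms by (auto intro!: SUP_least)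

lemma sup_dist_rat_refl [simp]: "sup_dist_rat d d = 0"
  using sup_dist_rat_le[of d d 0] by simp

lemma sup_dist_rat_triangle: "sup_dist_rat c e \<le> sup_dist_rat c d + sup_dist_rat d e"
proof (rule sup_dist_rat_le)
  fix x y
  have "ennreal \<bar>c x y - e x y\<bar> \<le> ennreal (\<bar>c x y - d x y\<bar> + \<bar>d x y - e x y\<bar>)"
    by (intro ennreal_leI) linarith
  also have "\<dots> = ennreal \<bar>c x y - d x y\<bar> + ennreal \<bar>d x y - e x y\<bar>"
    by (rule ennreal_plus) auto
  also have "\<dots> \<le> sup_dist_rat c d + sup_dist_rat d e"
    by (intro add_mono sup_dist_rat_ge)
  finally show "ennreal \<bar>c x y - e x y\<bar> \<le> sup_dist_rat c d + sup_dist_rat d e" .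
qed

lemma sup_dist_rat_perturb:
  assumes "d \<in> Met_rat" "0 \<le> \<epsilon>"
  shows "sup_dist_rat d (perturb \<epsilon> d) \<le> ennreal \<epsilon>"
proof (intro sup_dist_rat_le ennreal_leI)
  fix x y
  interpret Metric_space UNIV d using assms by (simp add: Met_rat_def)
  have "\<epsilon> * min (d x y) 1 \<le> \<epsilon> * 1"
    using \<open>0 \<le> \<epsilon>\<close> by (intro mult_left_mono) auto
  then show "\<bar>d x y - perturb \<epsilon> d x y\<bar> \<le> \<epsilon>"
    using \<open>0 \<le> \<epsilon>\<close> by (simp add: perturb_def)
qed

lemma openin_Met_rat_ball:
  assumes "d \<in> Met_rat" "r > 0"
  shows "openin Met_rat_topology {e \<in> Met_rat. sup_dist_rat d e < ennreal r}"
  unfolding Met_rat_topology_def using assms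
  by (intro topology_generated_by_Basis) blast

lemma topspace_Met_rat [simp]: "topspace Met_rat_topology = Met_rat"
proof
  show "topspace Met_rat_topology \<subseteq> Met_rat"
    unfolding Met_rat_topology_def topology_generated_by_topspace by blast
  show "Met_rat \<subseteq> topspace Met_rat_topology"
  proof
    fix d assume "d \<in> Met_rat"
    then show "d \<in> topspace Met_rat_topology"
      using openin_subset[OF openin_Met_rat_ball[of d 1]] by auto
  qed
qed

text \<open>The balls are given only as a subbase. Induction on the generation of \<open>W\<close>
  shows that every open set contains a ball around each of its points: intersections take the
  smaller radius, and an off-centre generating ball is handled by the triangle inequality.\<close>

lemma openin_Met_rat_contains_ball:
  assumes "openin Met_rat_topology W" "d \<in> W"
  shows "\<exists>\<delta>>0. {e \<in> Met_rat. sup_dist_rat d e < ennreal \<delta>} \<subseteq> W"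
proof -
  have "generate_topology_on
     {{e \<in> Met_rat. sup_dist_rat c e < ennreal r} | c r. c \<in> Met_rat \<and> r > 0} W"
    using assms(1) by (simp add: Met_rat_topology_def openin_topology_generated_by_iff)
  then show ?thesis
    using assms(2)
  proof (induction arbitrary: d)
    case Empty
    then show ?case by simp
  next
    case (Int a b)
    then obtain \<delta>1 \<delta>2 where *: "\<delta>1 > 0" "{e \<in> Met_rat. sup_dist_rat d e < ennreal \<delta>1} \<subseteq> a"
      "\<delta>2 > 0" "{e \<in> Met_rat. sup_dist_rat d e < ennreal \<delta>2} \<subseteq> b"
      by (meson IntD1 IntD2)
    have "sup_dist_rat d e < ennreal \<delta>1 \<and> sup_dist_rat d e < ennreal \<delta>2"
      if "sup_dist_rat d e < ennreal (min \<delta>1 \<delta>2)" for e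
      using that ennreal_leI[of "min \<delta>1 \<delta>2" \<delta>1] ennreal_leI[of "min \<delta>1 \<delta>2" \<delta>2]
      by (auto intro: less_le_trans)
    with * show ?case
      by (intro exI[of _ "min \<delta>1 \<delta>2"]) auto
  next
    case (UN K)
    then show ?case by (meson UnionE Union_upper subset_trans)
  next
    case (Basis s)
    then obtain c r where s: "s = {e \<in> Met_rat. sup_dist_rat c e < ennreal r}" "r > 0"
      by blast
    then have lt: "sup_dist_rat c d < ennreal r" using Basis by simp
    \<comment> \<open>The distance from \<open>c\<close> to \<open>d\<close> lies below
      \<open>r\<close>, so it is finite. This makes \<open>r - t\<close> a real radius and lets
      \<open>t\<close> be cancelled in the strict inequality below, which would fail at
      infinity.\<close>
    then obtain t where t: "sup_dist_rat c d = ennreal t" "0 \<le> t"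
      by (cases "sup_dist_rat c d") auto
    with lt have "t < r" using \<open>r > 0\<close> by (simp add: ennreal_less_iff)
    have "sup_dist_rat c e < ennreal r" if "sup_dist_rat d e < ennreal (r - t)" for e
    proof -
      have "sup_dist_rat c e \<le> ennreal t + sup_dist_rat d e"
        using sup_dist_rat_triangle[of c e d] t by simp
      also have "\<dots> < ennreal t + ennreal (r - t)"
        using that by (simp add: ennreal_add_left_cancel_less)
      also have "\<dots> = ennreal r"
        using \<open>0 \<le> t\<close> \<open>t < r\<close> by (simp flip: ennreal_plus)
      finally show ?thesis .
    qed
    with \<open>t < r\<close> show ?case
      unfolding s by (intro exI[of _ "r - t"]) auto
  qed
qed

text \<open>Evaluation at \<open>(x, y)\<close> changes by at most the sup distance. So if
  \<open>d x y\<close> differs from \<open>q\<close>, the ball of radius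
  \<open>\<bar>d x y - q\<bar>\<close> around \<open>d\<close> misses the level set.\<close>

lemma closedin_Met_rat_level_set:
  "closedin Met_rat_topology {d \<in> Met_rat. d x y = q}"
  unfolding closedin_def topspace_Met_rat
proof
  show "openin Met_rat_topology (Met_rat - {d \<in> Met_rat. d x y = q})"
  proof (subst openin_subopen, intro ballI)
    fix d assume d: "d \<in> Met_rat - {d \<in> Met_rat. d x y = q}"
    let ?B = "{e \<in> Met_rat. sup_dist_rat d e < ennreal \<bar>d x y - q\<bar>}"
    have "openin Met_rat_topology ?B" "d \<in> ?B"
      using d openin_Met_rat_ball[of d "\<bar>d x y - q\<bar>"] by auto
    moreover have "e x y \<noteq> q" if "e \<in> ?B" for e
      using that sup_dist_rat_ge[of d x y e] by auto
    ultimately show "\<exists>T. openin Met_rat_topology T \<and> d \<in> T \<and>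
        T \<subseteq> Met_rat - {d \<in> Met_rat. d x y = q}"
      by blast
  qed
qed auto

text \<open>The level set is its own closure, so it is enough that it has no interior point: a small
  perturbation of any of its members stays nearby but takes another value at
  \<open>(x, y)\<close>.\<close>

lemma nowhere_dense_Met_rat_level_set:
  assumes "x \<noteq> y"
  shows "nowhere_dense_in Met_rat_topology {d \<in> Met_rat. d x y = q}"
proof -
  let ?F = "{d \<in> Met_rat. d x y = q}"
  have "d \<notin> Met_rat_topology interior_of ?F" for d
  proof
    assume d: "d \<in> Met_rat_topology interior_of ?F"
    then have dq: "d \<in> Met_rat" "d x y = q"
      using subsetD[OF interior_of_subset d] by auto
    interpret Metric_space UNIV d using dq by (simp add: Met_rat_def)
    obtain \<delta> where \<delta>: "\<delta> > 0"
      "{e \<in> Met_rat. sup_dist_rat d e < ennreal \<delta>} \<subseteq> Met_rat_topology interior_of ?F"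
      using openin_Met_rat_contains_ball[OF openin_interior_of d] by blast
    \<comment> \<open>The perturbation bound is not strict while the ball is open, hence half of
      \<open>\<delta>\<close>.\<close>
    have "sup_dist_rat d (perturb (\<delta> / 2) d) \<le> ennreal (\<delta> / 2)"
      using sup_dist_rat_perturb[of d "\<delta> / 2"] dq \<delta>(1) by simp
    also have "\<dots> < ennreal \<delta>"
      using \<delta>(1) by (simp add: ennreal_less_iff)
    finally have "perturb (\<delta> / 2) d \<in> ?F"
      using \<delta> dq perturb_in_Met_rat[of d "\<delta> / 2"] interior_of_subset[of Met_rat_topology ?F]
      by auto
    \<comment> \<open>Both \<open>d\<close> and its perturbation now take the value \<open>q\<close>
      at \<open>(x, y)\<close>, so the added term \<open>\<delta> / 2 * min (d x y) 1\<close> must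
      vanish.\<close>
    then have "min (d x y) 1 = 0"
      using dq \<delta>(1) by (simp add: perturb_def)
    moreover have "d x y > 0"
      using assms mdist_pos_eq by simp
    ultimately show False by (simp add: min_def split: if_splits)
  qed
  then show ?thesis
    unfolding nowhere_dense_in_def
    by (auto simp: closure_of_closedin[OF closedin_Met_rat_level_set])
qed

lemma nowhere_dense_in_subset:
  assumes "nowhere_dense_in X T" "S \<subseteq> T"
  shows "nowhere_dense_in X S"
  using assms interior_of_mono[OF closure_of_mono[OF \<open>S \<subseteq> T\<close>, of X], of X]
  unfolding nowhere_dense_in_def by auto

lemma rational_valued_isometric:
  assumes "isometric_spaces X d Y e" "rational_valued Y e"
  shows "rational_valued X d"
proof -
  obtain f where f: "\<And>x. x \<in> X \<Longrightarrow> f x \<in> Y"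
      "\<And>x y. x \<in> X \<Longrightarrow> y \<in> X \<Longrightarrow> e (f x) (f y) = d x y"
    using assms(1) unfolding isometric_spaces_def isometric_embedding_def by blast
  show ?thesis
    unfolding rational_valued_def
  proof (intro ballI)
    fix x y assume "x \<in> X" "y \<in> X"
    then have "e (f x) (f y) \<in> \<rat>"
      using f(1) assms(2) by (simp add: rational_valued_def)
    then show "d x y \<in> \<rat>"
      using f(2) \<open>x \<in> X\<close> \<open>y \<in> X\<close> by simp
  qed
qed

theorem corollary3p13:
  fixes U :: "'a set" and \<rho> :: "'a \<Rightarrow> 'a \<Rightarrow> real"
  assumes "rational_Urysohn U \<rho>"
  shows "meager_in Met_rat_topology {d \<in> Met_rat. isometric_spaces UNIV d U \<rho>}"
proof -
  define S where "S = {d \<in> Met_rat. isometric_spaces UNIV d U \<rho>}"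
  \<comment> \<open>\<open>from_nat_into \<rat>\<close> enumerates the rationals. The level sets are
    cut down to \<open>S\<close> because \<open>meager_in\<close> asks for \<open>S\<close> to equal
    the union, not merely to be covered by it.\<close>
  define N where "N n = {d \<in> S. d 0 1 = from_nat_into \<rat> n}" for n
  \<comment> \<open>Rationality of the distances in \<open>U\<close> is pulled back along the
    isometry.\<close>
  have "d 0 1 \<in> \<rat>" if "d \<in> S" for d
    using that assms rational_valued_isometric[of UNIV d U \<rho>]
    by (auto simp: S_def rational_Urysohn_def rational_valued_def)
  then have "\<exists>n. d \<in> N n" if "d \<in> S" for d
    using that from_nat_into_surj[OF countable_rat, of "d 0 1"] by (auto simp: N_def intro: sym)
  then have "S = (\<Union>n. N n)"
    by (auto simp: N_def)
  moreover have "nowhere_dense_in Met_rat_topology (N n)" for n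
    by (rule nowhere_dense_in_subset[OF nowhere_dense_Met_rat_level_set[of 0 1]])
      (auto simp: N_def S_def)
  ultimately show ?thesis
    unfolding meager_in_def S_def by blast
qed

end
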